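(* Let $F$ be a distribution function on $\mathbb{R}$, and for $n\geq 1$ let $M_n$ be the maximum of $n$ independent real random variables all having distribution function $F$. Let $(g_n)_{n\geq 1}$ be a sequence of (deterministic) nondecreasing functions $g_n:\mathbb{R}\to\mathbb{R}$. The following are equivalent: (i) The distribution of $g_n(M_n)$ converges, as $n\to\infty$, to a nondegenerate limit. (ii) The sequence of functions $x\in(0,\infty)\mapsto g_n\circ F^\leftarrow(1-x/n)$, $n\geq 1$, converges almost everywhere to a nonconstant limit. In this case, writing $\omega$ for a standard exponential random variable and $h$ for the limiting function involved in (ii), the limiting distribution function of $g_n(M_n)$ is that of $h(\omega)$. Moreover, $h$ is continuous almost everywhere.
   Context: The quantile function pertaining to the distribution function $F$ is $F^\leftarrow(u)=\inf\{x : F(x)>u\}$, which is real-valued for $u\in(0,1)$. For a fixed $x\in(0,\infty)$, the quantity $g_n\circ F^\leftarrow(1-x/n)=g_n(F^\leftarrow(1-x/n))$ is considered for $n>x$, so that $1-x/n\in(0,1)$; this is enough to speak of its limit as $n\to\infty$. "Almost everywhere" is with respect to Lebesgue measure on $(0,\infty)$; the limit is a finite real number at almost every $x$, and the limiting function $h$ is the pointwise limit, defined on the set of $x$ where the sequence converges. Convergence of distributions means convergence in distribution (weak convergence) to a probability distribution on $\mathbb{R}$; a distribution is nondegenerate if it is not a point mass. *)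

theory Defs
  imports "HOL-Probability.Probability"
begin

text \<open>The strict inequality makes this the right-continuous version of the quantile function.
  It is meaningful only for \<open>u\<close> in the open unit interval; elsewhere \<open>Inf\<close> takes junk values.\<close>

definition quantile :: "(real \<Rightarrow> real) \<Rightarrow> real \<Rightarrow> real" where
  "quantile F u = Inf {x. F x > u}"

definition degenerate :: "real measure \<Rightarrow> bool" where
  "degenerate \<nu> \<longleftrightarrow> (\<exists>c. \<nu> = return borel c)"

text \<open>For fixed \<open>x > 0\<close> the terms with \<open>n \<le> x\<close>, where \<open>1 - x / n\<close> lies outside the open unit
  interval, are junk; they do not influence convergence or the limit as \<open>n\<close> tends to infinity.\<close>

definition tail_seq :: "(real \<Rightarrow> real) \<Rightarrow> (nat \<Rightarrow> real \<Rightarrow> real) \<Rightarrow> nat \<Rightarrow> real \<Rightarrow> real" where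
  "tail_seq F g n x = g n (quantile F (1 - x / real n))"

definition conv_set :: "(real \<Rightarrow> real) \<Rightarrow> (nat \<Rightarrow> real \<Rightarrow> real) \<Rightarrow> real set" where
  "conv_set F g = {x. 0 < x \<and> convergent (\<lambda>n. tail_seq F g n x)}"

text \<open>The pointwise limit. It is a total function, but only its values on \<^term>\<open>conv_set F g\<close>
  carry information, so its properties are to be stated relative to that set.\<close>

definition limit_fun :: "(real \<Rightarrow> real) \<Rightarrow> (nat \<Rightarrow> real \<Rightarrow> real) \<Rightarrow> real \<Rightarrow> real" where
  "limit_fun F g x = lim (\<lambda>n. tail_seq F g n x)"

end

theory Submission
  imports Defs
begin

text \<open>
  Write \<open>T\<^sub>n x = g\<^sub>n (quantile F (1 - x / n))\<close> and let \<open>H\<^sub>n\<close> be the distribution function of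
  \<open>g\<^sub>n (M\<^sub>n)\<close>. Since \<open>g\<^sub>n\<close> is nondecreasing, \<open>{z. g\<^sub>n z \<le> y}\<close> is an initial segment of the line;
  calling its probability under \<open>F\<close> \<open>p\<close>, independence gives \<open>H\<^sub>n y = p ^ n\<close>, while the quantile of order
  \<open>u\<close> lies in the segment if \<open>u < p\<close> and outside it if \<open>u > p\<close>. With \<open>u = 1 - x / n\<close> this
  becomes a duality between \<open>T\<^sub>n\<close> and \<open>H\<^sub>n\<close>: for \<open>0 < x < n\<close>,
  \<open>T\<^sub>n x \<le> y\<close> implies \<open>H\<^sub>n y \<ge> (1 - x / n) ^ n\<close>, and \<open>T\<^sub>n x > y\<close> implies
  \<open>H\<^sub>n y \<le> (1 - x / n) ^ n\<close>. As \<open>(1 - x / n) ^ n\<close> tends to \<open>exp (- x)\<close>, the functions \<open>T\<^sub>n\<close> and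
  \<open>H\<^sub>n\<close> are in the limit inverse to each other up to the change of variable \<open>x \<mapsto> exp (- x)\<close>.
  The asymptotic arguments see \<open>F\<close> and \<open>g\<^sub>n\<close> only through this duality, which is therefore isolated
  in the locale \<open>tail_duality\<close>.

  If \<open>H\<^sub>n\<close> converges weakly to a distribution function \<open>G\<close>, then \<open>T\<^sub>n x\<close> converges to the quantile
  of \<open>G\<close> of order \<open>exp (- x)\<close> unless \<open>G\<close> has a flat piece at that level; there are only
  countably many such levels (\<open>AE_conv_if_weak_conv\<close>). Conversely, if \<open>T\<^sub>n\<close> converges almost
  everywhere to \<open>h\<close>, then \<open>h\<close> is nonincreasing, and \<open>h x < y\<close> or \<open>h x > y\<close> bounds both the limit
  points of \<open>H\<^sub>n y\<close> and the probability of \<open>h \<omega> \<le> y\<close>, with \<open>\<omega>\<close> standard exponential, by \<open>exp (- x)\<close> from the same side. When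
  \<open>h \<omega>\<close> has no atom at \<open>y\<close>, such \<open>x\<close> are dense, and the two quantities agree
  (\<open>weak_conv_law_limf\<close>). Monotonicity of \<open>h\<close> also yields its continuity outside a countable set
  and shows that \<open>h\<close> is constant exactly if the law of \<open>h \<omega>\<close> is a point mass
  (\<open>law_limf_degenerate_iff\<close>), which together with the uniqueness of weak limits matches the two nontriviality conditions.
\<close>

section \<open>Almost everywhere on the half-line\<close>

lemma AE_lebesgue_on_half_line_iff:
  "(AE x in lebesgue_on {0<..}. R x) \<longleftrightarrow> (AE x in lborel. 0 < (x::real) \<longrightarrow> R x)"
  by (subst AE_restrict_space_iff) (simp_all add: AE_completion_iff)

lemma AE_exponentialI:
  assumes "distributed Q lborel W (exponential_density 1)"
    and R: "AE x in lborel. 0 < (x::real) \<longrightarrow> R x"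
  shows "AE s in Q. 0 < W s \<and> R (W s)"
proof -
  have W: "W \<in> borel_measurable Q"
    using assms(1) by (auto simp: distributed_def)
  \<comment> \<open>The density is positive at the origin too, which has to be discarded as a null set.\<close>
  have "AE x in lborel. x \<notin> {0::real}"
    by (intro AE_not_in countable_imp_null_set_lborel) auto
  with R have "AE x in density lborel (exponential_density 1). 0 < x \<and> R x"
    by (subst AE_density) (auto simp: exponential_density_def elim!: eventually_elim2)
  then have "AE x in distr Q lborel W. 0 < x \<and> R x"
    unfolding distributed_distr_eq_density[OF assms(1)] .
  then show ?thesis
    by (rule AE_distrD[rotated]) (use W in simp)
qed

section \<open>The quantile function\<close>

context real_distribution
begin

lemma superlevel_nonempty:
  assumes "u < 1"
  shows "{x. u < cdf M x} \<noteq> {}"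
  using order_tendstoD(1)[OF cdf_lim_at_top_prob assms] by (auto simp: eventually_at_top_linorder)

lemma superlevel_bdd_below:
  assumes "0 < u"
  shows "bdd_below {x. u < cdf M x}"
proof -
  obtain a where a: "cdf M a < u"
    using order_tendstoD(2)[OF cdf_lim_at_bot assms] by (auto simp: eventually_at_bot_linorder)
  have "a \<le> y" if "u < cdf M y" for y
    using cdf_nondecreasing[of y a] a that by (cases "a \<le> y") auto
  then show ?thesis by (auto intro!: bdd_belowI[of _ a])
qed

lemma cdf_gt_of_quantile_less:
  assumes "u < 1" "quantile (cdf M) u < y"
  shows "u < cdf M y"
proof -
  obtain w where "u < cdf M w" "w < y"
    using cInf_lessD[OF superlevel_nonempty[OF assms(1)], of y] assms(2)
    by (auto simp: quantile_def)
  then show ?thesis using cdf_nondecreasing[of w y] by auto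
qed

lemma cdf_le_of_less_quantile:
  assumes "0 < u" "y < quantile (cdf M) u"
  shows "cdf M y \<le> u"
proof (rule ccontr)
  assume "\<not> cdf M y \<le> u"
  then have "quantile (cdf M) u \<le> y"
    unfolding quantile_def by (intro cInf_lower superlevel_bdd_below[OF assms(1)]) auto
  with assms(2) show False by simp
qed

lemma quantile_mono_on: "mono_on {0<..<1} (quantile (cdf M))"
  unfolding quantile_def
  by (intro mono_onI cInf_superset_mono superlevel_nonempty superlevel_bdd_below) auto

text \<open>The quantile function is not monotone on the whole line: the infimum of all reals, below \<open>0\<close>,
  and the infimum of the empty set, from \<open>1\<close> on, are unrelated to its values in between. It is
  monotone on each of finitely many pieces, with the level \<open>0\<close> as a piece of its own.\<close>

lemma borel_measurable_quantile: "quantile (cdf M) \<in> borel_measurable borel"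
proof (rule measurable_piecewise_restrict[where C = "{{..<0}, {0}, {0<..<1}, {1..}}"])
  fix \<Omega> :: "real set" assume "\<Omega> \<in> {{..<0}, {0}, {0<..<1}, {1..}}"
  moreover have "mono_on {..<0} (quantile (cdf M))"
  proof (rule mono_onI)
    fix u v :: real assume "u \<in> {..<0}" "v \<in> {..<0}"
    then have "{x. u < cdf M x} = UNIV" "{x. v < cdf M x} = UNIV"
      using cdf_nonneg by (auto intro: less_le_trans)
    then show "quantile (cdf M) u \<le> quantile (cdf M) v" by (simp add: quantile_def)
  qed
  moreover have "mono_on {1..} (quantile (cdf M))"
  proof (rule mono_onI)
    fix u v :: real assume "u \<in> {1..}" "v \<in> {1..}"
    then have "{x. u < cdf M x} = {}" "{x. v < cdf M x} = {}"
      using cdf_bounded_prob by (auto simp: not_less intro: order_trans)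
    then show "quantile (cdf M) u \<le> quantile (cdf M) v" by (simp add: quantile_def)
  qed
  moreover have "mono_on {0} (quantile (cdf M))" by (auto simp: mono_on_def)
  ultimately show "quantile (cdf M) \<in> borel_measurable (restrict_space borel \<Omega>)"
    using quantile_mono_on by (auto intro: borel_measurable_mono_on_fnc)
qed auto

text \<open>A uniform random variable \<open>U\<close> turns into one with distribution function \<open>F\<close> when the quantile
  function is applied to it, so the quantile must fall into an initial segment \<open>S\<close> for \<open>U\<close> below
  the probability of \<open>S\<close> and outside for \<open>U\<close> above. The next two lemmas make this precise for
  every single level. The segment may be open or closed at its right end because a nondecreasing
  function can jump from either side.\<close>

lemma quantile_in_lower_set:
  assumes "0 < u" and S: "S \<in> sets borel" "\<And>y z. z \<in> S \<Longrightarrow> y \<le> z \<Longrightarrow> y \<in> S"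
    and "u < prob S"
  shows "quantile (cdf M) u \<in> S"
proof (rule ccontr)
  let ?z = "quantile (cdf M) u"
  assume n: "?z \<notin> S"
  have "prob {..<?z} \<le> u"
  proof (rule tendsto_upperbound[OF cdf_at_left])
    show "eventually (\<lambda>y. cdf M y \<le> u) (at_left ?z)"
      using cdf_le_of_less_quantile[OF \<open>0 < u\<close>]
      by (auto simp: eventually_at_filter intro!: always_eventually)
  qed simp
  moreover have "y < ?z" if "y \<in> S" for y
    using S(2)[of y ?z] n that by (cases "y < ?z") auto
  then have "prob S \<le> prob {..<?z}" by (intro finite_measure_mono) auto
  ultimately show False using \<open>u < prob S\<close> by simp
qed

lemma quantile_notin_lower_set:
  assumes "u < 1" and S: "S \<in> sets borel" "\<And>y z. z \<in> S \<Longrightarrow> y \<le> z \<Longrightarrow> y \<in> S"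
    and "prob S < u"
  shows "quantile (cdf M) u \<notin> S"
proof
  let ?z = "quantile (cdf M) u"
  assume z: "?z \<in> S"
  have "u \<le> cdf M ?z"
  proof (rule tendsto_lowerbound)
    show "(cdf M \<longlongrightarrow> cdf M ?z) (at_right ?z)"
      using cdf_is_right_cont by (simp add: continuous_within)
    show "eventually (\<lambda>y. u \<le> cdf M y) (at_right ?z)"
      using cdf_gt_of_quantile_less[OF \<open>u < 1\<close>]
      by (auto simp: eventually_at_filter intro!: always_eventually less_imp_le)
  qed simp
  also have "cdf M ?z \<le> prob S"
    using S(1) S(2)[OF z] by (auto simp: cdf_def2 intro!: finite_measure_mono)
  finally show False using \<open>prob S < u\<close> by simp
qed

end

section \<open>Asymptotic duality of tail functions and distribution functions\<close>

text \<open>The second assumption is the first with all inequalities reversed, so the duality is symmetric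
  except for ties; this is why the proofs below come in mirror pairs.\<close>

locale tail_duality =
  fixes T H :: "nat \<Rightarrow> real \<Rightarrow> real"
  assumes le_dual: "\<lbrakk>0 < x; x < real n; T n x \<le> y\<rbrakk> \<Longrightarrow> (1 - x / real n) ^ n \<le> H n y"
    and gt_dual: "\<lbrakk>0 < x; x < real n; y < T n x\<rbrakk> \<Longrightarrow> H n y \<le> (1 - x / real n) ^ n"
begin

definition conv :: "real set" where
  "conv = {x. 0 < x \<and> convergent (\<lambda>n. T n x)}"

definition limf :: "real \<Rightarrow> real" where
  "limf x = lim (\<lambda>n. T n x)"

lemma conv_pos: "x \<in> conv \<Longrightarrow> 0 < x"
  by (simp add: conv_def)

lemma tendsto_limf: "x \<in> conv \<Longrightarrow> (\<lambda>n. T n x) \<longlonglongrightarrow> limf x"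
  by (simp add: conv_def limf_def convergent_LIMSEQ_iff)

lemma exp_limit: "(\<lambda>n. (1 - x / real n) ^ n) \<longlonglongrightarrow> exp (- x)"
  using tendsto_exp_limit_sequentially[of "- x"] by simp

lemma eventually_index_gt: "eventually (\<lambda>n. x < real n) sequentially"
  using filterlim_real_sequentially by (simp add: filterlim_at_top_dense)

lemma eventually_H_gt:
  assumes "x \<in> conv" "limf x < y" "c < exp (- x)"
  shows "eventually (\<lambda>n. c < H n y) sequentially"
  using order_tendstoD(2)[OF tendsto_limf[OF assms(1)] assms(2)]
    order_tendstoD(1)[OF exp_limit assms(3)] eventually_index_gt[of x]
proof eventually_elim
  case (elim n)
  then show ?case
    using le_dual[of x n y] conv_pos[OF assms(1)] by linarith
qed

lemma eventually_H_less:
  assumes "x \<in> conv" "y < limf x" "exp (- x) < c"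
  shows "eventually (\<lambda>n. H n y < c) sequentially"
  using order_tendstoD(1)[OF tendsto_limf[OF assms(1)] assms(2)]
    order_tendstoD(2)[OF exp_limit assms(3)] eventually_index_gt[of x]
proof eventually_elim
  case (elim n)
  then show ?case
    using gt_dual[of x n y] conv_pos[OF assms(1)] by linarith
qed

text \<open>The duality forces monotonicity: if \<open>limf\<close> increased from \<open>x\<close> to \<open>x'\<close>, a value \<open>y\<close>
  between the two limits would force \<open>H n y\<close> to be eventually at least about \<open>exp (- x)\<close> and at
  most about the smaller number \<open>exp (- x')\<close>.\<close>

lemma limf_antimono:
  assumes "x \<in> conv" "x' \<in> conv" "x \<le> x'"
  shows "limf x' \<le> limf x"
proof (rule ccontr)
  assume *: "\<not> limf x' \<le> limf x"
  then have "x < x'"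
    using assms(3) by (cases "x = x'") auto
  then obtain c where c: "exp (- x') < c" "c < exp (- x)"
    using dense[of "exp (- x')" "exp (- x)"] by auto
  from * obtain y where y: "limf x < y" "y < limf x'"
    using dense[of "limf x" "limf x'"] by auto
  have "eventually (\<lambda>n. False) sequentially"
    using eventually_H_gt[OF assms(1) y(1) c(2)] eventually_H_less[OF assms(2) y(2) c(1)]
    by eventually_elim simp
  then show False by simp
qed

lemma AE_continuous_limf:
  "AE x in lborel. x \<in> conv \<longrightarrow> continuous (at x within conv) limf"
proof -
  have "mono_on conv (\<lambda>x. - limf x)"
    using limf_antimono by (auto simp: mono_on_def)
  from mono_on_ctble_discont[OF this]
  have "countable {x \<in> conv. \<not> continuous (at x within conv) (\<lambda>x. - limf x)}" .
  then have "AE x in lborel. x \<notin> {x \<in> conv. \<not> continuous (at x within conv) (\<lambda>x. - limf x)}"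
    by (intro AE_not_in countable_imp_null_set_lborel)
  then show ?thesis
  proof eventually_elim
    case (elim x)
    then show ?case
      using continuous_minus[of "at x within conv" "\<lambda>x. - limf x"] by auto
  qed
qed

text \<open>The limit is the quantile \<open>z\<close> of \<open>\<nu>\<close> of order \<open>exp (- x)\<close>. The distribution function always exceeds
  this level to the right of \<open>z\<close>. To the left of \<open>z\<close> it might stay equal to the level on an
  interval; that interval would contain a rational point, which the last assumption excludes.
  Strict inequality on both sides is what transfers to \<open>H n\<close> and, by duality, to \<open>T n\<close>.\<close>

lemma convergent_if_level_avoided:
  assumes "real_distribution \<nu>" "weak_conv H (cdf \<nu>)"
    and "0 < x" and avoid: "\<And>q. q \<in> \<rat> \<Longrightarrow> cdf \<nu> q \<noteq> exp (- x)"
  shows "convergent (\<lambda>n. T n x)"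
proof -
  interpret \<nu>: real_distribution \<nu> by fact
  define z where "z = quantile (cdf \<nu>) (exp (- x))"
  have above: "exp (- x) < cdf \<nu> y" if "z < y" for y
    using \<nu>.cdf_gt_of_quantile_less that \<open>0 < x\<close> by (simp add: z_def)
  have below: "cdf \<nu> y < exp (- x)" if yz: "y < z" for y
  proof -
    obtain q where q: "q \<in> \<rat>" "y < q" "q < z"
      using Rats_dense_in_real[OF yz] by auto
    have "cdf \<nu> q \<le> exp (- x)"
      using \<nu>.cdf_le_of_less_quantile q(3) by (simp add: z_def)
    with avoid[OF q(1)] have "cdf \<nu> q < exp (- x)" by simp
    then show ?thesis using \<nu>.cdf_nondecreasing[of y q] q(2) by simp
  qed
  have "countable {y. \<not> isCont (cdf \<nu>) y}"
    by (intro mono_ctble_discont monoI \<nu>.cdf_nondecreasing)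
  then have contpt: "\<exists>y. a < y \<and> y < b \<and> isCont (cdf \<nu>) y" if "a < b" for a b
    using real_interval_avoid_countable_set[OF that, of "{y. \<not> isCont (cdf \<nu>) y}"] by auto
  have lims: "(\<lambda>n. H n y) \<longlonglongrightarrow> cdf \<nu> y" if "isCont (cdf \<nu>) y" for y
    using assms(2) that by (auto simp: weak_conv_def)
  have "(\<lambda>n. T n x) \<longlonglongrightarrow> z"
  proof (rule order_tendstoI)
    fix a assume "a < z"
    then obtain y where y: "a < y" "y < z" "isCont (cdf \<nu>) y" using contpt by blast
    obtain c where c: "cdf \<nu> y < c" "c < exp (- x)"
      using dense[OF below[OF y(2)]] by blast
    show "eventually (\<lambda>n. a < T n x) sequentially"
      using order_tendstoD(2)[OF lims[OF y(3)] c(1)] order_tendstoD(1)[OF exp_limit c(2)]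
        eventually_index_gt[of x]
    proof eventually_elim
      case (elim n)
      then show ?case using le_dual[of x n y] \<open>0 < x\<close> y(1) by linarith
    qed
  next
    fix b assume "z < b"
    then obtain y where y: "z < y" "y < b" "isCont (cdf \<nu>) y" using contpt by blast
    obtain c where c: "exp (- x) < c" "c < cdf \<nu> y"
      using dense[OF above[OF y(1)]] by blast
    show "eventually (\<lambda>n. T n x < b) sequentially"
      using order_tendstoD(1)[OF lims[OF y(3)] c(2)] order_tendstoD(2)[OF exp_limit c(1)]
        eventually_index_gt[of x]
    proof eventually_elim
      case (elim n)
      then show ?case using gt_dual[of x n y] \<open>0 < x\<close> y(2) by linarith
    qed
  qed
  then show ?thesis by (auto simp: convergent_def)
qed

lemma AE_conv_if_weak_conv:
  assumes "real_distribution \<nu>" "weak_conv H (cdf \<nu>)"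
  shows "AE x in lborel. 0 < x \<longrightarrow> x \<in> conv"
proof -
  have "AE x in lborel. x \<notin> (\<lambda>q. - ln (cdf \<nu> q)) ` \<rat>"
    by (intro AE_not_in countable_imp_null_set_lborel countable_image countable_rat)
  then show ?thesis
  proof eventually_elim
    case (elim x)
    have "cdf \<nu> q \<noteq> exp (- x)" if "q \<in> \<rat>" for q
    proof
      assume "cdf \<nu> q = exp (- x)"
      then have "x = - ln (cdf \<nu> q)" by simp
      with that elim show False by blast
    qed
    then show ?case
      using convergent_if_level_avoided[OF assms] by (auto simp: conv_def)
  qed
qed

text \<open>Since \<open>limf\<close> is nonincreasing and \<open>W\<close> exceeds \<open>x\<close> with probability \<open>exp (- x)\<close>, the distribution
  function of \<open>limf W\<close> satisfies the duality in the limit (\<open>upper\<close> and \<open>lower\<close> in the proof). Comparing it with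
  \<open>H n\<close> requires points \<open>x\<close> for which \<open>exp (- x)\<close> falls strictly between two given numbers and
  \<open>limf x \<noteq> y\<close>; they exist because \<open>limf W\<close> has no atom at a continuity point \<open>y\<close>.\<close>

lemma weak_conv_law_limf:
  assumes ae: "AE x in lborel. 0 < x \<longrightarrow> x \<in> conv"
    and Q: "prob_space Q" and W: "distributed Q lborel W (exponential_density 1)"
    and meas: "(\<lambda>s. limf (W s)) \<in> borel_measurable Q"
    and H01: "\<And>n y. n \<ge> 1 \<Longrightarrow> 0 \<le> H n y" "\<And>n y. n \<ge> 1 \<Longrightarrow> H n y \<le> 1"
  shows "weak_conv H (cdf (distr Q borel (\<lambda>s. limf (W s))))"
  unfolding weak_conv_def
proof (intro allI impI)
  fix y
  let ?L = "distr Q borel (\<lambda>s. limf (W s))"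
  interpret Q: prob_space Q by fact
  interpret L: real_distribution ?L
    using meas by (auto intro!: real_distribution.intro Q.prob_space_distr
        simp: real_distribution_axioms_def)
  have W'[measurable]: "W \<in> borel_measurable Q"
    using W by (auto simp: distributed_def)
  note meas[measurable]
  assume "isCont (cdf ?L) y"
  then have null: "Q.prob {s \<in> space Q. limf (W s) = y} = 0"
    by (simp add: L.isCont_cdf measure_distr[OF meas] vimage_def Int_def conj_commute)
  have cdfL: "cdf ?L y = Q.prob {s \<in> space Q. limf (W s) \<le> y}"
    by (simp add: cdf_def2 measure_distr[OF meas] vimage_def Int_def conj_commute)
  have tail: "Q.prob {s \<in> space Q. x < W s} = exp (- x)" if "0 \<le> x" for x
    using Q.exponential_distributedD_gt[OF W that] by simp
  have aeW: "AE s in Q. 0 < W s \<and> W s \<in> conv"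
    by (rule AE_exponentialI[OF W ae])
  have upper: "cdf ?L y \<le> exp (- x)" if "x \<in> conv" "y < limf x" for x
  proof -
    have "AE s in Q. limf (W s) \<le> y \<longrightarrow> x < W s"
      using aeW
    proof eventually_elim
      case (elim s)
      then show ?case using limf_antimono[of "W s" x] that by force
    qed
    then have "cdf ?L y \<le> Q.prob {s \<in> space Q. x < W s}"
      unfolding cdfL by (intro Q.finite_measure_mono_AE) auto
    then show ?thesis using tail[of x] conv_pos[OF that(1)] by simp
  qed
  have lower: "exp (- x) \<le> cdf ?L y" if "x \<in> conv" "limf x < y" for x
  proof -
    have "AE s in Q. x < W s \<longrightarrow> limf (W s) \<le> y"
      using aeW
    proof eventually_elim
      case (elim s)
      then show ?case using limf_antimono[of x "W s"] that by force
    qed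
    then have "Q.prob {s \<in> space Q. x < W s} \<le> cdf ?L y"
      unfolding cdfL by (intro Q.finite_measure_mono_AE) auto
    then show ?thesis using tail[of x] conv_pos[OF that(1)] by simp
  qed
  have pick: "\<exists>x \<in> conv. a < exp (- x) \<and> exp (- x) < b \<and> limf x \<noteq> y"
    if ab: "0 \<le> a" "a < b" "b \<le> 1" for a b
  proof (rule ccontr)
    assume neg: "\<not> ?thesis"
    \<comment> \<open>The level \<open>a\<close> may be zero, so it is replaced by a positive one before taking logarithms.\<close>
    obtain a' where a': "a < a'" "a' < b" using dense[OF ab(2)] by blast
    define l r where "l = - ln b" and "r = - ln a'"
    have lr: "0 \<le> l" "l < r" using a' ab by (auto simp: l_def r_def)
    have rng: "a < exp (- x) \<and> exp (- x) < b" if "l < x" "x < r" for x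
    proof -
      have "exp (- x) < exp (ln b)" "exp (ln a') < exp (- x)"
        using that unfolding l_def r_def exp_less_cancel_iff by linarith+
      then show ?thesis using a' ab by simp
    qed
    have "AE s in Q. \<not> (l < W s \<and> \<not> r \<le> W s)"
    proof -
      have "AE s in Q. limf (W s) \<noteq> y"
        using null by (subst (asm) Q.prob_eq_0) auto
      then show ?thesis
        using aeW
      proof eventually_elim
        case (elim s)
        then show ?case using neg rng[of "W s"] by force
      qed
    qed
    \<comment> \<open>Almost surely \<open>W\<close> would avoid the interval from \<open>l\<close> to \<open>r\<close>; its midpoint shows the contradiction.\<close>
    then have "Q.prob {s \<in> space Q. l < W s} \<le> Q.prob {s \<in> space Q. (r + l) / 2 < W s}"
      using lr by (intro Q.finite_measure_mono_AE) (auto elim!: eventually_mono)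
    then show False using tail[of l] tail[of "(r + l) / 2"] lr by simp
  qed
  show "(\<lambda>n. H n y) \<longlonglongrightarrow> cdf ?L y"
  proof (rule order_tendstoI)
    fix a assume a: "a < cdf ?L y"
    show "eventually (\<lambda>n. a < H n y) sequentially"
    proof (cases "a < 0")
      case True
      then show ?thesis
        using H01(1)[of _ y] by (intro eventually_sequentiallyI[of 1]) (meson less_le_trans)
    next
      case False
      then obtain x where x: "x \<in> conv" "a < exp (- x)" "exp (- x) < cdf ?L y" "limf x \<noteq> y"
        using pick[of a "cdf ?L y"] a L.cdf_bounded_prob[of y] by auto
      with upper[of x] have "limf x < y" by force
      then show ?thesis using eventually_H_gt x by blast
    qed
  next
    fix b assume b: "cdf ?L y < b"
    show "eventually (\<lambda>n. H n y < b) sequentially"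
    proof (cases "1 < b")
      case True
      then show ?thesis
        using H01(2)[of _ y] by (intro eventually_sequentiallyI[of 1]) (meson le_less_trans)
    next
      case False
      then obtain x where x: "x \<in> conv" "cdf ?L y < exp (- x)" "exp (- x) < b" "limf x \<noteq> y"
        using pick[of "cdf ?L y" b] b L.cdf_nonneg[of y] by auto
      with lower[of x] have "y < limf x" by force
      then show ?thesis using eventually_H_less x by blast
    qed
  qed
qed

text \<open>For the harder direction, suppose \<open>limf W\<close> is almost surely \<open>c\<close>. If \<open>limf x > c\<close> at a single
  point, monotonicity gives \<open>limf > c\<close> on all earlier points, so \<open>W\<close> would almost surely exceed \<open>x\<close>;
  \<open>limf x < c\<close> is excluded in the same way. So even the value at an exceptional point is \<open>c\<close>.\<close>

lemma law_limf_degenerate_iff: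
  assumes ae: "AE x in lborel. 0 < x \<longrightarrow> x \<in> conv"
    and Q: "prob_space Q" and W: "distributed Q lborel W (exponential_density 1)"
    and meas: "(\<lambda>s. limf (W s)) \<in> borel_measurable Q"
  shows "degenerate (distr Q borel (\<lambda>s. limf (W s))) \<longleftrightarrow> limf constant_on conv"
proof
  assume "limf constant_on conv"
  then obtain c where c: "\<And>x. x \<in> conv \<Longrightarrow> limf x = c" by (auto simp: constant_on_def)
  interpret Q: prob_space Q by fact
  have "AE s in Q. limf (W s) = c"
    using AE_exponentialI[OF W ae] by eventually_elim (auto simp: c)
  then have "distr Q borel (\<lambda>s. limf (W s)) = distr Q borel (\<lambda>s. c)"
    using meas by (intro distr_cong_AE) auto
  also have "\<dots> = return borel c" by (simp add: Q.distr_const)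
  finally show "degenerate (distr Q borel (\<lambda>s. limf (W s)))" by (auto simp: degenerate_def)
next
  assume "degenerate (distr Q borel (\<lambda>s. limf (W s)))"
  then obtain c where c: "distr Q borel (\<lambda>s. limf (W s)) = return borel c"
    by (auto simp: degenerate_def)
  interpret Q: prob_space Q by fact
  have W'[measurable]: "W \<in> borel_measurable Q"
    using W by (auto simp: distributed_def)
  note meas[measurable]
  have "AE z in distr Q borel (\<lambda>s. limf (W s)). z = c"
    unfolding c by (subst AE_return) auto
  then have const: "AE s in Q. limf (W s) = c"
    using meas by (subst (asm) AE_distr_iff) auto
  have aeW: "AE s in Q. 0 < W s \<and> W s \<in> conv"
    by (rule AE_exponentialI[OF W ae])
  have tail: "Q.prob {s \<in> space Q. x < W s} = exp (- x)" if "0 \<le> x" for x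
    using Q.exponential_distributedD_gt[OF W that] by simp
  have "limf x = c" if x: "x \<in> conv" for x
  proof (rule antisym)
    show "limf x \<le> c"
    proof (rule ccontr)
      assume n: "\<not> limf x \<le> c"
      have "AE s in Q. x < W s"
        using const aeW
      proof eventually_elim
        case (elim s)
        then show ?case using limf_antimono[of "W s" x] x n by force
      qed
      then have "Q.prob {s \<in> space Q. x < W s} = 1" by (subst Q.prob_Collect_eq_1) auto
      then show False using tail[of x] conv_pos[OF x] by simp
    qed
    show "c \<le> limf x"
    proof (rule ccontr)
      assume n: "\<not> c \<le> limf x"
      have "AE s in Q. \<not> x < W s"
        using const aeW
      proof eventually_elim
        case (elim s)
        then show ?case using limf_antimono[of x "W s"] x n by force
      qed
      then have "Q.prob {s \<in> space Q. x < W s} = 0" by (subst Q.prob_Collect_eq_0) auto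
      then show False using tail[of x] conv_pos[OF x] by simp
    qed
  qed
  then show "limf constant_on conv" by (auto simp: constant_on_def)
qed

end

section \<open>The law of the maximum\<close>

lemma (in prob_space) cdf_mono_of_Max:
  fixes X :: "nat \<Rightarrow> 'a \<Rightarrow> real"
  assumes indep: "indep_vars (\<lambda>_. borel) X {..<n}" and "n \<ge> 1"
    and law: "\<And>i. i < n \<Longrightarrow> distr M borel (X i) = \<mu>"
    and Z: "\<And>s. s \<in> space M \<Longrightarrow> Z s = Max ((\<lambda>i. X i s) ` {..<n})"
    and "mono f"
  shows "(\<lambda>s. f (Z s)) \<in> borel_measurable M"
    and "cdf (distr M borel (\<lambda>s. f (Z s))) y = measure \<mu> {z. f z \<le> y} ^ n"
proof -
  have X: "X i \<in> borel_measurable M" if "i < n" for i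
    using indep that by (auto simp: indep_vars_def)
  have f[measurable]: "f \<in> borel_measurable borel"
    using \<open>mono f\<close> by (rule borel_measurable_mono)
  have "(\<lambda>s. Max ((\<lambda>i. X i s) ` {..<n})) \<in> borel_measurable M"
    using X by (intro borel_measurable_Max) auto
  then have "Z \<in> borel_measurable M"
    using Z by (subst measurable_cong) auto
  then show meas: "(\<lambda>s. f (Z s)) \<in> borel_measurable M"
    by measurable
  let ?S = "{z. f z \<le> y}"
  have S: "?S \<in> sets borel" by measurable
  have iff: "f (Z s) \<le> y \<longleftrightarrow> (\<forall>i<n. f (X i s) \<le> y)" if "s \<in> space M" for s
  proof
    assume *: "f (Z s) \<le> y"
    show "\<forall>i<n. f (X i s) \<le> y"
    proof (intro allI impI)
      fix i assume "i < n"
      then have "X i s \<le> Z s" by (auto simp: Z[OF that] intro!: Max_ge)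
      then show "f (X i s) \<le> y" using monoD[OF \<open>mono f\<close>] * order_trans by blast
    qed
  next
    assume *: "\<forall>i<n. f (X i s) \<le> y"
    have "Max ((\<lambda>i. X i s) ` {..<n}) \<in> (\<lambda>i. X i s) ` {..<n}"
      using \<open>n \<ge> 1\<close> by (intro Max_in) (auto simp: lessThan_empty_iff)
    then show "f (Z s) \<le> y" using * by (auto simp: Z[OF that])
  qed
  have "cdf (distr M borel (\<lambda>s. f (Z s))) y = prob {s \<in> space M. f (Z s) \<le> y}"
    by (simp add: cdf_def2 measure_distr[OF meas] vimage_def Int_def conj_commute)
  also have "{s \<in> space M. f (Z s) \<le> y} = (\<Inter>i\<in>{..<n}. X i -` ?S \<inter> space M)"
    using iff \<open>n \<ge> 1\<close> by (auto simp: Suc_le_eq)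
  also have "prob \<dots> = (\<Prod>i\<in>{..<n}. prob (X i -` ?S \<inter> space M))"
    using \<open>n \<ge> 1\<close> S by (intro indep_varsD[OF indep]) (auto simp: lessThan_empty_iff)
  also have "\<dots> = (\<Prod>i\<in>{..<n}. measure \<mu> ?S)"
  proof (intro prod.cong refl)
    fix i assume "i \<in> {..<n}"
    then show "prob (X i -` ?S \<inter> space M) = measure \<mu> ?S"
      using measure_distr[OF X S, of i] law[of i] by simp
  qed
  finally show "cdf (distr M borel (\<lambda>s. f (Z s))) y = measure \<mu> ?S ^ n" by simp
qed

text \<open>The characteristic functions of the two limits agree by continuity. The term with index \<open>0\<close>,
  about which nothing is known, is removed by a shift.\<close>

lemma weak_limit_unique:
  assumes "\<And>n. n \<ge> 1 \<Longrightarrow> real_distribution (N n)"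
    and "real_distribution \<nu>" "weak_conv_m N \<nu>" "real_distribution \<nu>'" "weak_conv_m N \<nu>'"
  shows "\<nu> = \<nu>'"
proof (rule Levy_uniqueness[OF assms(2,4)], rule ext)
  fix t
  have shift: "weak_conv_m (\<lambda>n. N (Suc n)) \<kappa>" if "weak_conv_m N \<kappa>" for \<kappa>
    unfolding weak_conv_m_def weak_conv_def
  proof (intro allI impI)
    fix y assume "isCont (cdf \<kappa>) y"
    with that have "(\<lambda>n. cdf (N n) y) \<longlonglongrightarrow> cdf \<kappa> y"
      by (simp add: weak_conv_m_def weak_conv_def)
    then show "(\<lambda>n. cdf (N (Suc n)) y) \<longlonglongrightarrow> cdf \<kappa> y" by (rule LIMSEQ_Suc)
  qed
  show "char \<nu> t = char \<nu>' t"
    by (rule LIMSEQ_unique[OF levy_continuity1[OF _ assms(2) shift] levy_continuity1[OF _ assms(4) shift]])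
      (use assms in auto)
qed

theorem theorem2p1:
  fixes F :: "real \<Rightarrow> real" and \<mu> :: "real measure"
    and P :: "nat \<Rightarrow> 'a measure" and X :: "nat \<Rightarrow> nat \<Rightarrow> 'a \<Rightarrow> real"
    and M :: "nat \<Rightarrow> 'a \<Rightarrow> real" and g :: "nat \<Rightarrow> real \<Rightarrow> real"
  assumes F_distribution_function: "real_distribution \<mu>" "F = cdf \<mu>"
    and P_prob: "\<And>n. n \<ge> 1 \<Longrightarrow> prob_space (P n)"
    and X_indep: "\<And>n. n \<ge> 1 \<Longrightarrow> prob_space.indep_vars (P n) (\<lambda>_. borel) (X n) {..<n}"
    and X_cdf: "\<And>n i. n \<ge> 1 \<Longrightarrow> i < n \<Longrightarrow> cdf (distr (P n) borel (X n i)) = F"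
    and M_max: "\<And>n s. n \<ge> 1 \<Longrightarrow> s \<in> space (P n) \<Longrightarrow> M n s = Max ((\<lambda>i. X n i s) ` {..<n})"
    and g_mono: "\<And>n. n \<ge> 1 \<Longrightarrow> mono (g n)"
  shows "((\<exists>\<nu>. real_distribution \<nu> \<and> \<not> degenerate \<nu> \<and>
             weak_conv_m (\<lambda>n. distr (P n) borel (\<lambda>s. g n (M n s))) \<nu>)
          \<longleftrightarrow>
          ((AE x in lebesgue_on {0<..}. convergent (\<lambda>n. tail_seq F g n x)) \<and>
             \<not> limit_fun F g constant_on conv_set F g))
       \<and> ((AE x in lebesgue_on {0<..}. convergent (\<lambda>n. tail_seq F g n x)) \<and>
             \<not> limit_fun F g constant_on conv_set F g
          \<longrightarrow>
          (\<forall>(Q :: 'b measure) W. prob_space Q \<and> distributed Q lborel W (exponential_density 1) \<longrightarrow>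
             (\<lambda>s. limit_fun F g (W s)) \<in> borel_measurable Q \<and>
             weak_conv_m (\<lambda>n. distr (P n) borel (\<lambda>s. g n (M n s)))
               (distr Q borel (\<lambda>s. limit_fun F g (W s)))) \<and>
          (AE x in lebesgue_on {0<..}. x \<in> conv_set F g \<and>
             continuous (at x within conv_set F g) (limit_fun F g)))"
proof -
  let ?N = "\<lambda>n. distr (P n) borel (\<lambda>s. g n (M n s))"
  let ?H = "\<lambda>n. cdf (?N n)"
  interpret \<mu>: real_distribution \<mu> by fact
  have meas: "(\<lambda>s. g n (M n s)) \<in> borel_measurable (P n)"
    and H_eq: "?H n y = \<mu>.prob {z. g n z \<le> y} ^ n" if n: "n \<ge> 1" for n y
  proof -
    interpret P: prob_space "P n" by (rule P_prob[OF n])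
    have law: "distr (P n) borel (X n i) = \<mu>" if "i < n" for i
    proof (rule cdf_unique)
      show "real_distribution (distr (P n) borel (X n i))"
        using X_indep[OF n] that
        by (auto simp: P.indep_vars_def real_distribution_def real_distribution_axioms_def
            intro!: P.prob_space_distr)
      show "cdf (distr (P n) borel (X n i)) = cdf \<mu>"
        using X_cdf[OF n that] F_distribution_function(2) by simp
    qed (rule F_distribution_function(1))
    show "(\<lambda>s. g n (M n s)) \<in> borel_measurable (P n)"
      and "?H n y = \<mu>.prob {z. g n z \<le> y} ^ n"
      using P.cdf_mono_of_Max[OF X_indep[OF n] n law M_max[OF n] g_mono[OF n]] by blast+
  qed
  have N_distr: "real_distribution (?N n)" if "n \<ge> 1" for n
    using prob_space.prob_space_distr[OF P_prob[OF that] meas[OF that]]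
    by (simp add: real_distribution_def real_distribution_axioms_def)
  interpret tail_duality "tail_seq F g" ?H
  proof
    fix x y :: real and n :: nat assume x: "0 < x" "x < real n"
    then have n: "n \<ge> 1" and u: "0 < 1 - x / real n" "1 - x / real n < 1" by auto
    let ?S = "{z. g n z \<le> y}"
    have [measurable]: "g n \<in> borel_measurable borel"
      by (rule borel_measurable_mono[OF g_mono[OF n]])
    have S: "?S \<in> sets borel" by measurable
    have down: "z' \<in> ?S" if "z \<in> ?S" "z' \<le> z" for z z'
      using that monoD[OF g_mono[OF n] that(2)] by auto
    show "(1 - x / real n) ^ n \<le> ?H n y" if "tail_seq F g n x \<le> y"
    proof -
      have "1 - x / real n \<le> \<mu>.prob ?S"
        using \<mu>.quantile_notin_lower_set[OF u(2) S down] that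
        by (force simp: tail_seq_def F_distribution_function(2))
      then show ?thesis unfolding H_eq[OF n] using u by (intro power_mono) auto
    qed
    show "?H n y \<le> (1 - x / real n) ^ n" if "y < tail_seq F g n x"
    proof -
      have "\<mu>.prob ?S \<le> 1 - x / real n"
        using \<mu>.quantile_in_lower_set[OF u(1) S down] that
        by (force simp: tail_seq_def F_distribution_function(2))
      then show ?thesis unfolding H_eq[OF n] by (intro power_mono) auto
    qed
  qed
  have conv_eq: "conv_set F g = conv" and limf_eq: "limit_fun F g = limf"
    by (auto simp: conv_set_def conv_def limit_fun_def limf_def)
  have H01: "0 \<le> ?H n y" "?H n y \<le> 1" if "n \<ge> 1" for n y
  proof -
    interpret real_distribution "?N n" by (rule N_distr[OF that])
    show "0 \<le> ?H n y" "?H n y \<le> 1" by (rule cdf_nonneg, rule cdf_bounded_prob)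
  qed
  have ae_iff: "(AE x in lebesgue_on {0<..}. convergent (\<lambda>n. tail_seq F g n x)) \<longleftrightarrow>
      (AE x in lborel. 0 < x \<longrightarrow> x \<in> conv)"
    by (simp add: AE_lebesgue_on_half_line_iff conv_def)
  have limf_meas: "limf \<in> borel_measurable borel"
  proof -
    have "tail_seq F g n \<in> borel_measurable borel" for n
    proof (cases "n = 0")
      \<comment> \<open>Division by zero makes this term constant in its argument.\<close>
      case True
      then show ?thesis by (simp add: tail_seq_def[abs_def])
    next
      case False
      then have [measurable]: "g n \<in> borel_measurable borel"
        by (intro borel_measurable_mono g_mono) simp
      note \<mu>.borel_measurable_quantile[measurable]
      show ?thesis
        unfolding tail_seq_def[abs_def] F_distribution_function(2) by measurable
    qed
    then show ?thesis unfolding limf_def[abs_def] by (intro borel_measurable_lim_metric)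
  qed
  have law: "(\<lambda>s. limf (W s)) \<in> borel_measurable Q"
      "real_distribution (distr Q borel (\<lambda>s. limf (W s)))"
    if "prob_space Q" "distributed Q lborel W (exponential_density 1)" for Q :: "'c measure" and W
  proof -
    interpret Q: prob_space Q by fact
    have "W \<in> borel_measurable Q" using that(2) by (auto simp: distributed_def)
    then show m: "(\<lambda>s. limf (W s)) \<in> borel_measurable Q"
      using limf_meas by (rule measurable_compose)
    show "real_distribution (distr Q borel (\<lambda>s. limf (W s)))"
      using Q.prob_space_distr[OF m] by (simp add: real_distribution_def real_distribution_axioms_def)
  qed
  \<comment> \<open>A concrete exponential variable: it provides the limit law in one direction and in the other
    identifies a given weak limit as the law of \<open>limf\<close> applied to it.\<close>
  let ?E = "density lborel (exponential_density 1)"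
  have E: "prob_space ?E" "distributed ?E lborel (\<lambda>x. x) (exponential_density 1)"
    by (auto simp: prob_space_exponential_density distributed_def distr_id2)
  show ?thesis
    unfolding conv_eq limf_eq ae_iff
  proof (intro conjI impI iffI)
    assume "\<exists>\<nu>. real_distribution \<nu> \<and> \<not> degenerate \<nu> \<and> weak_conv_m ?N \<nu>"
    then obtain \<nu> where \<nu>: "real_distribution \<nu>" "\<not> degenerate \<nu>" "weak_conv_m ?N \<nu>" by blast
    show ae: "AE x in lborel. 0 < x \<longrightarrow> x \<in> conv"
      using AE_conv_if_weak_conv[OF \<nu>(1)] \<nu>(3) by (simp add: weak_conv_m_def)
    have "weak_conv_m ?N (distr ?E borel (\<lambda>s. limf s))"
      unfolding weak_conv_m_def by (rule weak_conv_law_limf[OF ae E law(1)[OF E] H01])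
    then have "\<nu> = distr ?E borel (\<lambda>s. limf s)"
      using weak_limit_unique[OF N_distr \<nu>(1,3) law(2)[OF E]] by blast
    then show "\<not> limf constant_on conv"
      using law_limf_degenerate_iff[OF ae E law(1)[OF E]] \<nu>(2) by simp
  next
    assume *: "(AE x in lborel. 0 < x \<longrightarrow> x \<in> conv) \<and> \<not> limf constant_on conv"
    then show "\<exists>\<nu>. real_distribution \<nu> \<and> \<not> degenerate \<nu> \<and> weak_conv_m ?N \<nu>"
      using law(2)[OF E] law_limf_degenerate_iff[OF _ E law(1)[OF E]]
        weak_conv_law_limf[OF _ E law(1)[OF E] H01]
      unfolding weak_conv_m_def by blast
  next
    assume *: "(AE x in lborel. 0 < x \<longrightarrow> x \<in> conv) \<and> \<not> limf constant_on conv"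
    show "\<forall>(Q :: 'b measure) W. prob_space Q \<and> distributed Q lborel W (exponential_density 1) \<longrightarrow>
             (\<lambda>s. limf (W s)) \<in> borel_measurable Q \<and>
             weak_conv_m ?N (distr Q borel (\<lambda>s. limf (W s)))"
      unfolding weak_conv_m_def
      using law(1) weak_conv_law_limf[OF conjunct1[OF *] _ _ law(1) H01] by blast
    show "AE x in lebesgue_on {0<..}. x \<in> conv \<and> continuous (at x within conv) limf"
      unfolding AE_lebesgue_on_half_line_iff
      using conjunct1[OF *] AE_continuous_limf by eventually_elim blast
  qed
qed

end
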